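(* Let $k\geqslant 2$ be a fixed integer and let $G\in\mathcal{G}(n,p)$, where the expected degree $d=d(n)=np$ satisfies $d\geqslant c$ and $d^{k-1}=o(n)$ for some large enough constant $c$. With high probability, there exists a $k$-matching in $G$ with size $(1+o(1))\frac{kn\log d}{4d^{k-1}}$.
   Context: $\mathcal{G}(n,p)$ is the Erdős–Rényi random graph on vertex set $[n]$ in which each possible edge is present independently with probability $p$. The distance $d_G(u,v)$ between two vertices is the number of edges of a shortest path between them in $G$. For a fixed positive integer $k$, a $k$-matching of $G$ is a set $M$ of edges of $G$ such that for any two distinct edges $e,f\in M$ and any endpoint $u$ of $e$ and endpoint $v$ of $f$, $u\ne v$ and $d_G(u,v)\geqslant k$ (no two edges of $M$ are within distance $k$); its size is its number of edges. "With high probability" means with probability tending to $1$ as $n\to\infty$; $o(1)$ denotes a quantity tending to $0$ as $n\to\infty$ (or as $c\to\infty$); logarithms are natural. *)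

theory Defs
  imports "HOL-Probability.Probability" "HOL-Library.Extended_Nat" "HOL-Library.Landau_Symbols"
begin

text \<open>A graph is given by its set of edges, an edge being the two-element set of its endpoints.\<close>

definition possible_edges :: "nat \<Rightarrow> nat set set" where
  "possible_edges n = {e. e \<subseteq> {1..n} \<and> card e = 2}"

text \<open>The Erdos--Renyi distribution, as a distribution on the edge set of the graph. The
  library's \<open>bernoulli_pmf p\<close> is a Bernoulli variable of parameter \<open>p\<close> only
  for \<open>0 \<le> p \<le> 1\<close>.\<close>

definition gnp :: "nat \<Rightarrow> real \<Rightarrow> nat set set pmf" where
  "gnp n p = map_pmf (\<lambda>present. {e \<in> possible_edges n. present e})
     (Pi_pmf (possible_edges n) False (\<lambda>_. bernoulli_pmf p))"

definition is_path :: "'a set set \<Rightarrow> 'a \<Rightarrow> 'a list \<Rightarrow> 'a \<Rightarrow> bool" where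
  "is_path E u xs v \<longleftrightarrow>
     xs \<noteq> [] \<and> hd xs = u \<and> last xs = v \<and> distinct xs \<and> successively (\<lambda>x y. {x, y} \<in> E) xs"

text \<open>A path with vertex list \<open>xs\<close> has \<open>length xs - 1\<close> edges. Vertices
  in different components are at distance \<open>\<infinity>\<close>, the infimum of the empty set.\<close>

definition graph_dist :: "'a set set \<Rightarrow> 'a \<Rightarrow> 'a \<Rightarrow> enat" where
  "graph_dist E u v = (INF xs\<in>{xs. is_path E u xs v}. enat (length xs - 1))"

definition k_matching :: "nat \<Rightarrow> 'a set set \<Rightarrow> 'a set set \<Rightarrow> bool" where
  "k_matching k E M \<longleftrightarrow> M \<subseteq> E \<and>
     (\<forall>e\<in>M. \<forall>f\<in>M. e \<noteq> f \<longrightarrow> (\<forall>u\<in>e. \<forall>v\<in>f. u \<noteq> v \<and> enat k \<le> graph_dist E u v))"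

end

theory Submission
  imports Defs "HOL-Real_Asymp.Real_Asymp"
begin

text \<open>
  Only a lower bound on the size is at stake, as a subset of a \<open>k\<close>-matching is again one. If \<open>E\<close> has no
  \<open>k\<close>-matching of size \<open>m\<close>, a maximum one \<open>M\<close> has fewer than \<open>m\<close> edges, and by maximality every edge
  of \<open>E\<close> touches the ball of radius \<open>k - 1\<close> about \<open>U = \<Union>M\<close>. The latter event does not involve the
  edges inside \<open>U\<close>, so it is independent of \<open>M \<subseteq> E\<close>, and a union bound over \<open>M\<close> costs a factor of
  about \<open>d\<close> to the power \<open>k m\<close>. To bound its probability, explore from \<open>U\<close> layer by layer: by
  Chernoff each of the first \<open>k - 2\<close> layers grows by a factor of at most \<open>(1 + \<delta>) d\<close>, so a vertex
  escapes the ball with probability at least about \<open>s = exp (- 2 m d\<^sup>k\<^sup>-\<^sup>1 / n)\<close>, which exceeds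
  \<open>d\<close> to the power \<open>- k / 2\<close> exactly when \<open>m\<close> is below the claimed size. Then about \<open>n s\<close> vertices escape,
  and no pair of them has been exposed, so all edges are touched with probability at most about
  \<open>exp (- d n s\<^sup>2)\<close>, which beats the union bound.
\<close>

section \<open>Random subsets\<close>

text \<open>Expectation over a random subset of \<open>F\<close> containing each element independently with probability \<open>p\<close>.\<close>

definition rexp :: "real \<Rightarrow> 'a set \<Rightarrow> ('a set \<Rightarrow> real) \<Rightarrow> real" where
  "rexp p F f = (\<Sum>E\<in>Pow F. p ^ card E * (1 - p) ^ card (F - E) * f E)"

lemma rexp_empty [simp]: "rexp p {} f = f {}"
  by (simp add: rexp_def)

lemma rexp_insert:
  assumes "finite F" "x \<notin> F"
  shows "rexp p (insert x F) f = p * rexp p F (\<lambda>E. f (insert x E)) + (1 - p) * rexp p F f"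
proof -
  have disj: "Pow F \<inter> insert x ` Pow F = {}" using assms by auto
  have inj: "inj_on (insert x) (Pow F)"
    using assms by (auto simp: inj_on_def) 
  have 1: "(\<Sum>E\<in>Pow F. p ^ card E * (1 - p) ^ card (insert x F - E) * f E)
      = (1 - p) * rexp p F f"
    unfolding rexp_def sum_distrib_left
  proof (rule sum.cong)
    fix E assume E: "E \<in> Pow F"
    then have "insert x F - E = insert x (F - E)" using assms by auto
    moreover have "card (insert x (F - E)) = Suc (card (F - E))"
      using assms E by (simp add: finite_subset)
    ultimately show "p ^ card E * (1 - p) ^ card (insert x F - E) * f E =
        (1 - p) * (p ^ card E * (1 - p) ^ card (F - E) * f E)" by simp
  qed simp
  have 2: "(\<Sum>E\<in>insert x ` Pow F. p ^ card E * (1 - p) ^ card (insert x F - E) * f E)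
      = p * rexp p F (\<lambda>E. f (insert x E))"
    unfolding rexp_def sum_distrib_left sum.reindex[OF inj]
  proof (rule sum.cong)
    fix E assume E: "E \<in> Pow F"
    then have "insert x F - insert x E = F - E" using assms by auto
    moreover have "card (insert x E) = Suc (card E)"
      using assms E by (meson PowD card_insert_disjoint finite_subset subsetD)
    ultimately show "((\<lambda>E. p ^ card E * (1 - p) ^ card (insert x F - E) * f E) \<circ> insert x) E =
        p * (p ^ card E * (1 - p) ^ card (F - E) * f (insert x E))" by simp
  qed simp
  show ?thesis
    unfolding rexp_def[of p "insert x F"] Pow_insert
    using assms disj by (subst sum.union_disjoint) (auto simp: 1 2)
qed

lemma rexp_cong: "(\<And>E. E \<subseteq> F \<Longrightarrow> f E = g E) \<Longrightarrow> rexp p F f = rexp p F g"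
  unfolding rexp_def by (intro sum.cong) auto

lemma rexp_mono:
  assumes "0 \<le> p" "p \<le> 1" "\<And>E. E \<subseteq> F \<Longrightarrow> f E \<le> g E"
  shows "rexp p F f \<le> rexp p F g"
  unfolding rexp_def using assms by (intro sum_mono mult_left_mono) auto

lemma rexp_cmult: "rexp p F (\<lambda>E. c * f E) = c * rexp p F f"
  unfolding rexp_def sum_distrib_left by (intro sum.cong) auto

lemma rexp_multc: "rexp p F (\<lambda>E. f E * c) = rexp p F f * c"
  using rexp_cmult[of p F c f] by (simp add: mult.commute)

lemma rexp_add: "rexp p F (\<lambda>E. f E + g E) = rexp p F f + rexp p F g"
  unfolding rexp_def by (simp add: distrib_left sum.distrib)

lemma rexp_sum: "rexp p F (\<lambda>E. \<Sum>i\<in>I. f i E) = (\<Sum>i\<in>I. rexp p F (f i))"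
  unfolding rexp_def by (simp add: sum_distrib_left sum.swap[of _ I])

lemma rexp_const: "finite F \<Longrightarrow> rexp p F (\<lambda>_. c) = c"
  by (induction F rule: finite_induct) (simp_all add: rexp_insert algebra_simps)

lemma rexp_Un:
  assumes "finite F" "finite G" "F \<inter> G = {}"
  shows "rexp p (F \<union> G) f = rexp p F (\<lambda>A. rexp p G (\<lambda>B. f (A \<union> B)))"
  using assms
proof (induction F arbitrary: f rule: finite_induct)
  case (insert x F)
  then have "x \<notin> F \<union> G" by auto
  with insert show ?case by (simp add: rexp_insert)
qed simp

lemma rexp_Int:
  assumes "finite F" "G \<subseteq> F"
  shows "rexp p F (\<lambda>E. f (E \<inter> G)) = rexp p G f"
proof -
  have fin: "finite G" using assms finite_subset by blast
  have "rexp p F (\<lambda>E. f (E \<inter> G)) = rexp p (G \<union> (F - G)) (\<lambda>E. f (E \<inter> G))"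
    using assms by (simp add: Un_absorb1)
  also have "\<dots> = rexp p G (\<lambda>A. rexp p (F - G) (\<lambda>B. f ((A \<union> B) \<inter> G)))"
    using assms fin by (subst rexp_Un) auto
  also have "\<dots> = rexp p G (\<lambda>A. rexp p (F - G) (\<lambda>B. f A))"
    by (intro rexp_cong arg_cong[where f = f]) auto
  also have "\<dots> = rexp p G f"
    using assms by (simp add: rexp_const)
  finally show ?thesis .
qed

lemma rexp_superset:
  assumes "finite F"
  shows "rexp p F (\<lambda>E. of_bool (F \<subseteq> E)) = p ^ card F"
proof -
  have "rexp p F (\<lambda>E. of_bool (F \<subseteq> E)) = (\<Sum>E\<in>{F}. p ^ card E * (1 - p) ^ card (F - E) * of_bool (F \<subseteq> E))"
    unfolding rexp_def using assms by (intro sum.mono_neutral_right) auto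
  then show ?thesis by simp
qed

lemma rexp_is_empty:
  assumes "finite F"
  shows "rexp p F (\<lambda>E. of_bool (E = {})) = (1 - p) ^ card F"
proof -
  have "rexp p F (\<lambda>E. of_bool (E = {})) = (\<Sum>E\<in>{{}}. p ^ card E * (1 - p) ^ card (F - E) * of_bool (E = {}))"
    unfolding rexp_def using assms by (intro sum.mono_neutral_right) auto
  then show ?thesis by simp
qed

lemma sum_Pow_power_card:
  fixes x :: real
  assumes "finite F"
  shows "(\<Sum>M\<in>Pow F. x ^ card M) = (1 + x) ^ card F"
proof -
  have "(\<Sum>M\<in>Pow F. x ^ card M) = (\<Sum>M\<in>Pow F. (\<Prod>i\<in>M. x) * (\<Prod>i\<in>F-M. 1))" by simp
  also have "\<dots> = (\<Prod>i\<in>F. x + 1)"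
    using prod_add[OF assms, of "\<lambda>_. x" "\<lambda>_. 1"] by simp
  finally show ?thesis by (simp add: add.commute)
qed

text \<open>The bridge from the pmf to finite sums: the later estimates are all made with
  \<open>rexp\<close>, where induction on the edge set and marginalisation are elementary. The
  induction step conditions on the coin of \<open>x\<close>.\<close>

lemma prob_random_subset:
  assumes "finite F" "0 \<le> p" "p \<le> 1"
  shows "measure_pmf.prob (map_pmf (\<lambda>present. {e \<in> F. present e})
      (Pi_pmf F False (\<lambda>_. bernoulli_pmf p))) S = rexp p F (indicator S)"
  using assms
proof (induction F arbitrary: S rule: finite_induct)
  case empty
  then show ?case by (simp add: indicator_def)
next
  case (insert x F)
  let ?P = "Pi_pmf F False (\<lambda>_. bernoulli_pmf p)"
  let ?q = "map_pmf (\<lambda>present. {e \<in> F. present e}) ?P"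
  define g where "g b = map_pmf (\<lambda>A. if b then insert x A else A) ?q" for b
  have "map_pmf (\<lambda>present. {e \<in> insert x F. present e})
      (Pi_pmf (insert x F) False (\<lambda>_. bernoulli_pmf p))
     = map_pmf (\<lambda>(b, f). {e \<in> insert x F. (f(x := b)) e}) (pair_pmf (bernoulli_pmf p) ?P)"
    using insert.hyps by (simp add: Pi_pmf_insert map_pmf_comp case_prod_beta')
  also have "\<dots> = map_pmf (\<lambda>(b, f). if b then insert x {e \<in> F. f e} else {e \<in> F. f e})
      (pair_pmf (bernoulli_pmf p) ?P)"
    using insert.hyps by (intro map_pmf_cong refl) (auto split: if_splits)
  also have "\<dots> = bernoulli_pmf p \<bind> g"
    by (simp add: g_def[abs_def] map_pmf_def pair_pmf_def bind_assoc_pmf bind_return_pmf)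
  finally have eq: "map_pmf (\<lambda>present. {e \<in> insert x F. present e})
      (Pi_pmf (insert x F) False (\<lambda>_. bernoulli_pmf p)) = bernoulli_pmf p \<bind> g" .
  have "finite (set_pmf ?q)"
    by (rule finite_subset[of _ "Pow F"]) (use insert.hyps in auto)
  then have "finite (set_pmf (g b))" for b by (simp add: g_def)
  then have "measure_pmf.expectation (bernoulli_pmf p \<bind> g) (indicator S) =
      (\<Sum>b\<in>UNIV. pmf (bernoulli_pmf p) b *\<^sub>R measure_pmf.expectation (g b) (indicat_real S))"
    by (intro pmf_expectation_bind) auto
  then have "measure_pmf.prob (bernoulli_pmf p \<bind> g) S =
      p * measure_pmf.prob (g True) S + (1 - p) * measure_pmf.prob (g False) S"
    using insert.prems by (simp add: UNIV_bool)
  also have "measure_pmf.prob (g True) S = measure_pmf.prob ?q (insert x -` S)"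
    by (simp only: g_def if_True measure_map_pmf)
  also have "\<dots> = rexp p F (\<lambda>E. indicator S (insert x E))"
    unfolding insert.IH[OF insert.prems] by (intro rexp_cong) (simp add: indicator_def)
  also have "measure_pmf.prob (g False) S = rexp p F (indicator S)"
    unfolding insert.IH[OF insert.prems, symmetric] by (simp add: g_def)
  finally show ?case
    unfolding eq rexp_insert[OF insert.hyps] .
qed

section \<open>Layer exploration\<close>

definition pairs :: "'a set \<Rightarrow> 'a set set" where
  "pairs X = {e. e \<subseteq> X \<and> card e = 2}"

definition cross :: "'a set \<Rightarrow> 'a set \<Rightarrow> 'a set set" where
  "cross L X = (\<lambda>(u, v). {u, v}) ` (L \<times> X)"

definition nbrs :: "'a set set \<Rightarrow> 'a set \<Rightarrow> 'a set \<Rightarrow> 'a set" where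
  "nbrs E L X = {v \<in> X. \<exists>u\<in>L. {u, v} \<in> E}"

text \<open>When no edge joins \<open>X\<close> to the outside of \<open>L \<union> X\<close>, this is the set of vertices of \<open>X\<close> at distance more
  than \<open>j\<close> from \<open>L\<close>.\<close>

fun unreached :: "nat \<Rightarrow> 'a set \<Rightarrow> 'a set \<Rightarrow> 'a set set \<Rightarrow> 'a set" where
  "unreached 0 X L E = X"
| "unreached (Suc j) X L E = unreached j (X - nbrs E L X) (nbrs E L X) E"

definition edgeless :: "'a set set \<Rightarrow> 'a set \<Rightarrow> bool" where
  "edgeless E X \<longleftrightarrow> E \<inter> pairs X = {}"

lemma possible_edges_eq: "possible_edges n = pairs {1..n}"
  by (simp add: possible_edges_def pairs_def)

lemma finite_pairs [simp]: "finite X \<Longrightarrow> finite (pairs X)"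
  by (rule finite_subset[of _ "Pow X"]) (auto simp: pairs_def)

lemma finite_cross [simp]: "finite L \<Longrightarrow> finite X \<Longrightarrow> finite (cross L X)"
  by (simp add: cross_def)

lemma pairs_mono: "X \<subseteq> Y \<Longrightarrow> pairs X \<subseteq> pairs Y"
  by (auto simp: pairs_def)

lemma card_pairs: "finite X \<Longrightarrow> real (card (pairs X)) = real (card X) * (real (card X) - 1) / 2"
proof -
  assume "finite X"
  then have "card (pairs X) = card X choose 2" by (simp add: pairs_def n_subsets)
  moreover have "real (card X choose 2) = real (card X) * (real (card X) - 1) / 2"
    by (cases "card X") (auto simp: choose_two real_of_nat_div algebra_simps)
  ultimately show ?thesis by simp
qed

lemma in_cross: "e \<in> cross L X \<longleftrightarrow> (\<exists>u\<in>L. \<exists>v\<in>X. e = {u, v})"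
  by (auto simp: cross_def)

lemma cross_Int_pairs: "L \<inter> X = {} \<Longrightarrow> cross L X \<inter> pairs X = {}"
  by (fastforce simp: in_cross pairs_def)

lemma cross_subset_pairs: "L \<inter> X = {} \<Longrightarrow> L \<subseteq> Y \<Longrightarrow> X \<subseteq> Y \<Longrightarrow> cross L X \<subseteq> pairs Y"
  by (fastforce simp: in_cross pairs_def card_insert_if)

lemma nbrs_subset: "nbrs E L X \<subseteq> X"
  by (auto simp: nbrs_def)

lemma nbrs_cong: "E \<inter> cross L X = E' \<inter> cross L X \<Longrightarrow> nbrs E L X = nbrs E' L X"
  unfolding nbrs_def by (auto simp: in_cross set_eq_iff)

lemma unreached_subset: "unreached j X L E \<subseteq> X"
proof (induction j arbitrary: X L)
  case (Suc j)
  show ?case using Suc[of "X - nbrs E L X" "nbrs E L X"] by auto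
qed simp

text \<open>The exploration queries no edge inside \<open>L\<close>. This locality is the source of
  the independence between the edges of a matching and the event that the ball around them touches
  every edge.\<close>

lemma unreached_cong:
  assumes "L \<inter> X = {}" "E \<inter> (cross L X \<union> pairs X) = E' \<inter> (cross L X \<union> pairs X)"
  shows "unreached j X L E = unreached j X L E'"
  using assms
proof (induction j arbitrary: X L)
  case (Suc j)
  have eq: "nbrs E L X = nbrs E' L X"
    using Suc.prems by (intro nbrs_cong) blast
  let ?N = "nbrs E' L X"
  have "cross ?N (X - ?N) \<union> pairs (X - ?N) \<subseteq> pairs X"
    using nbrs_subset[of E' L X] by (intro Un_least cross_subset_pairs pairs_mono) auto
  then have "unreached j (X - ?N) ?N E = unreached j (X - ?N) ?N E'"
    using Suc.prems(2) by (intro Suc.IH) auto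
  then show ?case by (simp add: eq)
qed simp

lemma edgeless_unreached_cong:
  assumes "L \<inter> X = {}" "E \<inter> (cross L X \<union> pairs X) = E' \<inter> (cross L X \<union> pairs X)"
  shows "edgeless E (unreached j X L E) \<longleftrightarrow> edgeless E' (unreached j X L E')"
proof -
  have "pairs (unreached j X L E') \<subseteq> pairs X" by (intro pairs_mono unreached_subset)
  then have "E \<inter> pairs (unreached j X L E') = E' \<inter> pairs (unreached j X L E')"
    using assms(2) by auto
  then show ?thesis
    by (simp add: edgeless_def unreached_cong[OF assms])
qed

text \<open>The start is only required to lie outside \<open>X\<close>, not in \<open>L\<close>: a
  walk may step back into an earlier layer, and this weaker hypothesis survives the induction. The
  second vertex of the walk cannot lie in \<open>X - nbrs E L X\<close>, so dropping the first
  vertex gives a walk for the next layer.\<close>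

lemma unreached_walk:
  assumes "\<And>u v. u \<notin> X \<Longrightarrow> u \<notin> L \<Longrightarrow> v \<in> X \<Longrightarrow> {u, v} \<notin> E"
    and "z \<in> unreached j X L E" "xs \<noteq> []" "hd xs \<notin> X" "last xs = z"
    and "successively (\<lambda>x y. {x, y} \<in> E) xs"
  shows "length xs > Suc j"
  using assms
proof (induction j arbitrary: X L xs)
  case 0
  then show ?case by (cases xs rule: remdups_adj.cases) auto
next
  case (Suc j)
  obtain a where "a # tl xs = xs" using Suc.prems(3) by (cases xs) auto
  moreover have "tl xs \<noteq> []"
  proof
    assume "tl xs = []"
    then have "hd xs = z" using Suc.prems(3,5) by (cases xs) auto
    then show False using Suc.prems(2,4) unreached_subset[of "Suc j" X L E] by auto
  qed
  ultimately obtain b ys where xs: "xs = a # b # ys" by (metis list.collapse)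
  let ?N = "nbrs E L X"
  have "b \<notin> X - ?N"
  proof
    assume b: "b \<in> X - ?N"
    then have "{a, b} \<in> E" "a \<notin> X" using Suc.prems(4,6) xs by auto
    with b Suc.prems(1)[of a b] show False by (auto simp: nbrs_def)
  qed
  moreover have "{u, v} \<notin> E" if "u \<notin> X - ?N" "u \<notin> ?N" "v \<in> X - ?N" for u v
    using that Suc.prems(1)[of u v] by (auto simp: nbrs_def)
  ultimately have "length (b # ys) > Suc j"
    using Suc.prems xs by (intro Suc.IH[of "X - ?N" ?N]) auto
  then show ?case by (simp add: xs)
qed

section \<open>Generating function and tail bounds for the size of one layer\<close>

lemma rexp_nbrs:
  assumes "finite L" "finite X" "L \<inter> X = {}"
  shows "rexp p (cross L X) (\<lambda>E. a ^ card (nbrs E L X) * b ^ card (X - nbrs E L X))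
    = (a * (1 - (1 - p) ^ card L) + b * (1 - p) ^ card L) ^ card X"
  using assms(2,1,3)
proof (induction X rule: finite_induct)
  case empty
  then show ?case by (simp add: cross_def nbrs_def)
next
  case (insert v X)
  \<comment> \<open>The edges between \<open>L\<close> and \<open>v\<close> form a star disjoint
    from the stars of the other vertices. Hence \<open>v\<close> becomes a neighbour independently
    of them, with probability \<open>1 - (1 - p) ^ card L\<close>, and contributes one
    factor.\<close>
  have eq: "cross L (insert v X) = cross L {v} \<union> cross L X"
    by (auto simp: cross_def)
  have disj: "cross L {v} \<inter> cross L X = {}"
    using insert.prems insert.hyps by (auto simp: in_cross doubleton_eq_iff)
  have inj: "inj_on (\<lambda>u. {u, v}) L"
    by (auto simp: inj_on_def doubleton_eq_iff)
  have "cross L {v} = (\<lambda>u. {u, v}) ` L" by (auto simp: in_cross)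
  then have card: "card (cross L {v}) = card L"
    using card_image[OF inj] by simp
  have nb: "nbrs (A \<union> B) L (insert v X) = (if A = {} then {} else {v}) \<union> nbrs B L X"
    if A: "A \<subseteq> cross L {v}" and B: "B \<subseteq> cross L X" for A B
  proof -
    have 1: "{u, v} \<notin> B" if "u \<in> L" for u
      using B disj that unfolding disjoint_iff subset_iff in_cross by blast
    have 2: "{u, w} \<notin> A" if "u \<in> L" "w \<in> X" for u w
      using A disj that unfolding disjoint_iff subset_iff in_cross by blast
    have 3: "A = {} \<longleftrightarrow> \<not> (\<exists>u\<in>L. {u, v} \<in> A)"
      using A unfolding subset_iff in_cross by blast
    show ?thesis using 1 2 insert.hyps unfolding 3 by (auto simp: nbrs_def)
  qed
  have "rexp p (cross L (insert v X))
      (\<lambda>E. a ^ card (nbrs E L (insert v X)) * b ^ card (insert v X - nbrs E L (insert v X)))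
    = rexp p (cross L {v}) (\<lambda>A. rexp p (cross L X) (\<lambda>B.
        (if A = {} then b else a) * (a ^ card (nbrs B L X) * b ^ card (X - nbrs B L X))))"
    unfolding eq
  proof (subst rexp_Un)
    show "rexp p (cross L {v}) (\<lambda>A. rexp p (cross L X) (\<lambda>B.
          a ^ card (nbrs (A \<union> B) L (insert v X)) * b ^ card (insert v X - nbrs (A \<union> B) L (insert v X))))
      = rexp p (cross L {v}) (\<lambda>A. rexp p (cross L X) (\<lambda>B.
        (if A = {} then b else a) * (a ^ card (nbrs B L X) * b ^ card (X - nbrs B L X))))"
    proof (intro rexp_cong)
      fix A B assume AB: "A \<subseteq> cross L {v}" "B \<subseteq> cross L X"
      have fin: "finite (nbrs B L X)" and notin: "v \<notin> nbrs B L X"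
        using insert.hyps nbrs_subset[of B L X] finite_subset by auto
      have "insert v X - nbrs B L X = insert v (X - nbrs B L X)"
        using notin by auto
      moreover have "insert v X - insert v (nbrs B L X) = X - nbrs B L X"
        using insert.hyps by auto
      ultimately show "a ^ card (nbrs (A \<union> B) L (insert v X)) * b ^ card (insert v X - nbrs (A \<union> B) L (insert v X))
        = (if A = {} then b else a) * (a ^ card (nbrs B L X) * b ^ card (X - nbrs B L X))"
        using AB fin notin insert.hyps by (simp add: nb)
    qed
  qed (use insert disj in auto)
  also have "\<dots> = rexp p (cross L {v}) (\<lambda>A. a + (b - a) * of_bool (A = {}))
      * (a * (1 - (1 - p) ^ card L) + b * (1 - p) ^ card L) ^ card X"
    unfolding rexp_cmult rexp_multc using insert
    by (intro arg_cong2[where f = "(*)"] rexp_cong) auto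
  also have "rexp p (cross L {v}) (\<lambda>A. a + (b - a) * of_bool (A = {}))
      = a * (1 - (1 - p) ^ card L) + b * (1 - p) ^ card L"
    unfolding rexp_add rexp_cmult using insert.prems
    by (subst rexp_is_empty) (auto simp: rexp_const card algebra_simps)
  finally show ?case using insert.hyps by simp
qed

text \<open>A Chernoff bound: Markov's inequality for \<open>a ^ card (nbrs E L X)\<close>,
  evaluated by \<open>rexp_nbrs\<close> with \<open>b = 1\<close>. Bernoulli's inequality bounds the
  chance of being a neighbour by \<open>p * card L\<close>, so \<mu> dominates the mean.\<close>

lemma nbrs_card_upper_tail:
  fixes \<delta> \<mu> p :: real
  assumes "finite L" "finite X" "L \<inter> X = {}" "0 \<le> p" "p \<le> 1" "0 < \<delta>" "\<delta> \<le> 1"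
    and \<mu>: "p * card L * card X \<le> \<mu>"
  shows "rexp p (cross L X) (\<lambda>E. of_bool ((1 + \<delta>) * \<mu> < card (nbrs E L X))) \<le> exp (- (\<delta>\<^sup>2 * \<mu> / 4))"
proof -
  \<comment> \<open>With this tilt and exp x <= 1 + x + x^2 on [0, 1], the exponent -(\<delta>/2)(1
    + \<delta>)\<mu> + (\<delta>/2 + \<delta>^2/4)\<mu> is exactly -\<delta>^2 \<mu>/4.\<close>
  define a where "a = exp (\<delta> / 2)"
  have a1: "1 \<le> a" using assms by (simp add: a_def)
  have a2: "a \<le> 1 + \<delta> / 2 + (\<delta> / 2)\<^sup>2" unfolding a_def using assms by (intro exp_bound) auto
  have \<mu>0: "0 \<le> \<mu>" using \<mu> assms by (smt (verit) mult_nonneg_nonneg of_nat_0_le_iff)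
  define r where "r = (1 - p) ^ card L"
  have "1 + card L * (- p) \<le> (1 + (- p)) ^ card L"
    using assms by (intro Bernoulli_inequality) auto
  then have r: "1 - r \<le> p * card L" by (simp add: r_def mult.commute)
  have r01: "0 \<le> r" "r \<le> 1" using assms by (auto simp: r_def power_le_one)
  have "rexp p (cross L X) (\<lambda>E. of_bool ((1 + \<delta>) * \<mu> < card (nbrs E L X)))
     \<le> rexp p (cross L X) (\<lambda>E. exp (- (\<delta> / 2 * ((1 + \<delta>) * \<mu>))) *
          (a ^ card (nbrs E L X) * 1 ^ card (X - nbrs E L X)))"
  proof (intro rexp_mono assms)
    fix E
    have "1 \<le> exp (- (\<delta> / 2 * ((1 + \<delta>) * \<mu>))) * a ^ card (nbrs E L X)"
      if "(1 + \<delta>) * \<mu> < card (nbrs E L X)"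
    proof -
      have "\<delta> / 2 * ((1 + \<delta>) * \<mu>) \<le> \<delta> / 2 * card (nbrs E L X)"
        using that assms by (intro mult_left_mono) auto
      then show ?thesis
        unfolding a_def exp_of_nat_mult[symmetric] exp_add[symmetric] by (simp add: mult.commute)
    qed
    then show "of_bool ((1 + \<delta>) * \<mu> < card (nbrs E L X)) \<le> exp (- (\<delta> / 2 * ((1 + \<delta>) * \<mu>))) *
          (a ^ card (nbrs E L X) * 1 ^ card (X - nbrs E L X))"
      using a1 by auto
  qed
  also have "\<dots> = exp (- (\<delta> / 2 * ((1 + \<delta>) * \<mu>))) * (a * (1 - r) + 1 * r) ^ card X"
    unfolding rexp_cmult r_def using assms by (subst rexp_nbrs) auto
  also have "a * (1 - r) + 1 * r = 1 + (a - 1) * (1 - r)" by (simp add: algebra_simps)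
  also have "(1 + (a - 1) * (1 - r)) ^ card X \<le> exp ((a - 1) * (1 - r)) ^ card X"
    using a1 r01 by (intro power_mono exp_ge_add_one_self add_nonneg_nonneg mult_nonneg_nonneg) auto
  also have "\<dots> = exp ((a - 1) * ((1 - r) * card X))"
    unfolding exp_of_nat_mult[symmetric] by (simp only: mult_ac)
  also have "\<dots> \<le> exp ((a - 1) * \<mu>)"
  proof -
    have "(1 - r) * card X \<le> p * card L * card X" using r by (intro mult_right_mono) auto
    then show ?thesis using \<mu> a1 by (simp add: mult_left_mono)
  qed
  also have "\<dots> \<le> exp ((\<delta> / 2 + (\<delta> / 2)\<^sup>2) * \<mu>)"
    using a2 \<mu>0 by (simp add: mult_right_mono)
  also have "exp (- (\<delta> / 2 * ((1 + \<delta>) * \<mu>))) * \<dots> = exp (- (\<delta>\<^sup>2 * \<mu> / 4))"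
  proof -
    have "- (\<delta> / 2 * ((1 + \<delta>) * \<mu>)) + (\<delta> / 2 + (\<delta> / 2)\<^sup>2) * \<mu> = - (\<delta>\<^sup>2 * \<mu> / 4)"
      by (simp add: power2_eq_square algebra_simps)
    then show ?thesis unfolding exp_add[symmetric] by simp
  qed
  finally show ?thesis by simp
qed

text \<open>Markov's inequality for exp (-1) to the number of non-neighbours, by
  \<open>rexp_nbrs\<close> with \<open>a = 1\<close>. The constant 3/5 comes from exp 1 >= 5/2,
  which gives 1 - r + b r <= 1 - 3r/5.\<close>

lemma non_nbrs_card_lower_tail:
  fixes h p :: real
  assumes "finite L" "finite X" "L \<inter> X = {}" "0 \<le> p" "p \<le> 1"
  shows "rexp p (cross L X) (\<lambda>E. of_bool (card (X - nbrs E L X) < h))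
    \<le> exp (h - 3 / 5 * (1 - p) ^ card L * card X)"
proof -
  define b where "b = exp (- 1 :: real)"
  have "1 + 1 + 1\<^sup>2 / 2 \<le> exp (1::real)" by (intro exp_lower_Taylor_quadratic) auto
  then have b: "0 \<le> b" "b \<le> 2 / 5" by (auto simp: b_def exp_minus field_simps)
  define r where "r = (1 - p) ^ card L"
  have r01: "0 \<le> r" "r \<le> 1" using assms by (auto simp: r_def power_le_one)
  have "rexp p (cross L X) (\<lambda>E. of_bool (card (X - nbrs E L X) < h))
     \<le> rexp p (cross L X) (\<lambda>E. exp h * (1 ^ card (nbrs E L X) * b ^ card (X - nbrs E L X)))"
  proof (intro rexp_mono assms)
    fix E
    have "1 \<le> exp h * b ^ card (X - nbrs E L X)" if "card (X - nbrs E L X) < h"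
      using that by (simp add: b_def exp_of_nat_mult[symmetric] exp_add[symmetric])
    then show "of_bool (card (X - nbrs E L X) < h) \<le>
        exp h * (1 ^ card (nbrs E L X) * b ^ card (X - nbrs E L X))"
      using b by auto
  qed
  also have "\<dots> = exp h * (1 * (1 - r) + b * r) ^ card X"
    unfolding rexp_cmult r_def using assms by (subst rexp_nbrs) auto
  also have "(1 * (1 - r) + b * r) ^ card X \<le> exp (- (3 / 5 * r)) ^ card X"
  proof (intro power_mono)
    have "b * r \<le> 2 / 5 * r" using b r01 by (intro mult_right_mono) auto
    then show "1 * (1 - r) + b * r \<le> exp (- (3 / 5 * r))"
      using exp_ge_add_one_self[of "- (3 / 5 * r)"] by simp
    show "0 \<le> 1 * (1 - r) + b * r" using b r01 by auto
  qed
  also have "exp h * exp (- (3 / 5 * r)) ^ card X = exp (h - 3 / 5 * r * card X)"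
    by (simp add: exp_of_nat_mult[symmetric] exp_add[symmetric] mult_ac)
  finally show ?thesis by (simp add: r_def)
qed

text \<open>In the graph on \<open>L \<union> X\<close>, the event says that every edge meeting
  \<open>X\<close> but not \<open>L\<close> touches the ball of radius \<open>j\<close> about
  \<open>L\<close>. Only edges meeting \<open>X\<close> are sampled, so the value is also the
  probability conditional on any edges inside \<open>L\<close>.\<close>

definition covered_prob :: "real \<Rightarrow> nat \<Rightarrow> 'a set \<Rightarrow> 'a set \<Rightarrow> real" where
  "covered_prob p j X L = rexp p (cross L X \<union> pairs X) (\<lambda>E. of_bool (edgeless E (unreached j X L E)))"

lemma covered_prob_nonneg: "0 \<le> p \<Longrightarrow> p \<le> 1 \<Longrightarrow> 0 \<le> covered_prob p j X L"
  unfolding covered_prob_def rexp_def by (intro sum_nonneg) auto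

lemma covered_prob_le_1:
  assumes "finite X" "finite L" "0 \<le> p" "p \<le> 1"
  shows "covered_prob p j X L \<le> 1"
proof -
  have "covered_prob p j X L \<le> rexp p (cross L X \<union> pairs X) (\<lambda>_. 1)"
    unfolding covered_prob_def using assms by (intro rexp_mono) auto
  then show ?thesis using assms by (simp add: rexp_const)
qed

lemma covered_prob_0:
  assumes "finite X" "finite L"
  shows "covered_prob p 0 X L = (1 - p) ^ card (pairs X)"
proof -
  have "covered_prob p 0 X L = rexp p (pairs X) (\<lambda>E. of_bool (E = {}))"
    unfolding covered_prob_def using assms
    by (subst rexp_Int[of "cross L X \<union> pairs X" "pairs X", symmetric]) (auto simp: edgeless_def)
  then show ?thesis using assms by (simp add: rexp_is_empty)
qed

text \<open>Exposing \<open>cross L X\<close> fixes the next layer, while \<open>pairs X\<close> is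
  still unexposed and independent of it. By locality the remaining exploration reads only part of
  \<open>pairs X\<close>; the other pairs, such as those inside the new layer, are integrated
  out.\<close>

lemma covered_prob_Suc:
  assumes "finite X" "finite L" "L \<inter> X = {}"
  shows "covered_prob p (Suc j) X L =
    rexp p (cross L X) (\<lambda>A. covered_prob p j (X - nbrs A L X) (nbrs A L X))"
proof -
  have "covered_prob p (Suc j) X L = rexp p (cross L X) (\<lambda>A. rexp p (pairs X)
     (\<lambda>B. of_bool (edgeless (A \<union> B) (unreached (Suc j) X L (A \<union> B)))))"
    unfolding covered_prob_def using assms cross_Int_pairs[OF assms(3)] by (subst rexp_Un) auto
  also have "\<dots> = rexp p (cross L X) (\<lambda>A. covered_prob p j (X - nbrs A L X) (nbrs A L X))"
  proof (intro rexp_cong)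
    fix A assume A: "A \<subseteq> cross L X"
    define N where "N = nbrs A L X"
    let ?G = "cross N (X - N) \<union> pairs (X - N)"
    have "N \<subseteq> X" by (auto simp: N_def nbrs_def)
    then have G: "?G \<subseteq> pairs X"
      by (intro Un_least cross_subset_pairs pairs_mono) auto
    have "rexp p (pairs X) (\<lambda>B. of_bool (edgeless (A \<union> B) (unreached (Suc j) X L (A \<union> B))))
      = rexp p (pairs X) (\<lambda>B. of_bool (edgeless (B \<inter> ?G) (unreached j (X - N) N (B \<inter> ?G))))"
    proof (intro rexp_cong)
      fix B assume B: "B \<subseteq> pairs X"
      have "nbrs (A \<union> B) L X = N"
        unfolding N_def using B cross_Int_pairs[OF assms(3)] by (intro nbrs_cong) auto
      moreover have "edgeless (A \<union> B) (unreached j (X - N) N (A \<union> B)) \<longleftrightarrow>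
          edgeless (B \<inter> ?G) (unreached j (X - N) N (B \<inter> ?G))"
        using A G cross_Int_pairs[OF assms(3)] by (intro edgeless_unreached_cong) auto
      ultimately show "of_bool (edgeless (A \<union> B) (unreached (Suc j) X L (A \<union> B))) =
        (of_bool (edgeless (B \<inter> ?G) (unreached j (X - N) N (B \<inter> ?G))) :: real)" by simp
    qed
    also have "\<dots> = covered_prob p j (X - N) N"
      unfolding covered_prob_def using assms G by (intro rexp_Int) auto
    finally show "rexp p (pairs X) (\<lambda>B. of_bool (edgeless (A \<union> B) (unreached (Suc j) X L (A \<union> B))))
      = covered_prob p j (X - nbrs A L X) (nbrs A L X)" by (simp add: N_def)
  qed
  finally show ?thesis .
qed

text \<open>Either fewer than \<open>h\<close> vertices escape, which is a lower tail event, or the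
  escaping vertices span at least h(h - 1)/2 >= h^2/4 unexposed pairs, all of which must be
  absent.\<close>

lemma covered_prob_1_le:
  fixes h p :: real
  assumes "finite X" "finite L" "L \<inter> X = {}" "0 \<le> p" "p \<le> 1" "2 \<le> h"
  shows "covered_prob p 1 X L \<le> exp (h - 3 / 5 * (1 - p) ^ card L * card X) + exp (- (p * h\<^sup>2 / 4))"
proof -
  have "covered_prob p 1 X L = rexp p (cross L X) (\<lambda>A. (1 - p) ^ card (pairs (X - nbrs A L X)))"
    unfolding One_nat_def covered_prob_Suc[OF assms(1-3)]
    using assms finite_subset[OF nbrs_subset] by (intro rexp_cong covered_prob_0) auto
  also have "\<dots> \<le> rexp p (cross L X) (\<lambda>A. of_bool (card (X - nbrs A L X) < h) + exp (- (p * h\<^sup>2 / 4)))"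
  proof (intro rexp_mono assms)
    fix A
    define S where "S = X - nbrs A L X"
    have S: "finite S" using assms by (simp add: S_def)
    have "(1 - p) ^ card (pairs S) \<le> exp (- (p * h\<^sup>2 / 4))" if "\<not> card S < h"
    proof -
      have "(1 - p) ^ card (pairs S) \<le> exp (- p) ^ card (pairs S)"
        using assms exp_ge_add_one_self[of "- p"] by (intro power_mono) auto
      also have "\<dots> = exp (- (p * card (pairs S)))"
        unfolding exp_of_nat_mult[symmetric] by (simp add: mult.commute)
      also have "\<dots> \<le> exp (- (p * h\<^sup>2 / 4))"
      proof -
        have "h * (h - 1) \<le> card S * (real (card S) - 1)"
          using that assms by (intro mult_mono) auto
        moreover have "h\<^sup>2 / 4 \<le> h * (h - 1) / 2"
        proof -
          have "h * 2 \<le> h * h" using assms by (intro mult_left_mono) auto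
          then show ?thesis by (simp add: power2_eq_square algebra_simps)
        qed
        ultimately have "h\<^sup>2 / 4 \<le> card (pairs S)"
          unfolding card_pairs[OF S] by linarith
        then have "p * (h\<^sup>2 / 4) \<le> p * card (pairs S)" using assms by (intro mult_left_mono)
        then show ?thesis by simp
      qed
      finally show ?thesis .
    qed
    moreover have "(1 - p) ^ card (pairs S) \<le> 1" using assms by (intro power_le_one) auto
    ultimately show "(1 - p) ^ card (pairs (X - nbrs A L X)) \<le>
        of_bool (card (X - nbrs A L X) < h) + exp (- (p * h\<^sup>2 / 4))"
      by (cases "card S < h") (auto simp: S_def[symmetric] add_increasing2)
  qed
  also have "\<dots> \<le> exp (h - 3 / 5 * (1 - p) ^ card L * card X) + exp (- (p * h\<^sup>2 / 4))"
    unfolding rexp_add using assms by (intro add_mono non_nbrs_card_lower_tail) (auto simp: rexp_const)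
  finally show ?thesis .
qed

text \<open>Here \<open>l\<close> bounds the current layer and becomes \<open>a * l\<close> in the
  next, so that \<open>a ^ j * l\<close>, the bound for the last layer before escape, is invariant;
  \<open>l0\<close> is a common lower bound for the successive \<open>l\<close>, giving every layer
  the same failure term. The assumption on \<open>card X\<close> reserves room for the later layers:
  since \<open>a \<ge> 2\<close>, their sizes \<open>a * l\<close>, ..., \<open>a ^ j * l\<close>
  sum to at most \<open>2 * a ^ j * l - 2 * l\<close>, leaving n/2 vertices at the end.\<close>

lemma covered_prob_le:
  fixes \<delta> s l l0 p :: real and n :: nat
  defines "a \<equiv> (1 + \<delta>) * (n * p)"
  assumes p: "0 \<le> p" "p < 1" and \<delta>: "0 < \<delta>" "\<delta> \<le> 1" and a: "2 \<le> a"
    and s: "0 < s" "8 \<le> n * s" "s \<le> (1 - p) powr (a ^ j * l)"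
    and X: "finite X" "finite L" "L \<inter> X = {}" "real (card L) \<le> l" "0 \<le> l0" "l0 \<le> l"
      "card X \<le> n" "n / 2 + 2 * a ^ j * l - 2 * l \<le> real (card X)"
  shows "covered_prob p (Suc j) X L \<le> j * exp (- (\<delta>\<^sup>2 * (n * p * l0) / 4))
    + (exp (- (n * s / 20)) + exp (- (n * p * (n * s\<^sup>2) / 64)))"
  using s X
proof (induction j arbitrary: X L l)
  case 0
  have cX: "n / 2 \<le> card X" using 0 by simp
  have "s \<le> (1 - p) powr card L"
    using 0 p powr_mono'[of "real (card L)" l "1 - p"] by auto
  then have sL: "s \<le> (1 - p) ^ card L" using p by (simp add: powr_realpow)
  \<comment> \<open>The mean number of escaping vertices is at least n s/2, and the threshold
    \<open>h = n * s / 4\<close> is half of that. The exponent is then at most n s (1/4 - 3/10) = -n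
    s/20, and \<open>8 \<le> n * s\<close> ensures \<open>2 \<le> h\<close>.\<close>
  have "covered_prob p 1 X L \<le> exp (n * s / 4 - 3 / 5 * (1 - p) ^ card L * card X)
     + exp (- (p * (n * s / 4)\<^sup>2 / 4))"
    using 0 p by (intro covered_prob_1_le) auto
  also have "exp (n * s / 4 - 3 / 5 * (1 - p) ^ card L * card X) \<le> exp (- (n * s / 20))"
  proof -
    have "s * (n / 2) \<le> (1 - p) ^ card L * card X"
      using sL cX 0 p by (intro mult_mono) auto
    then show ?thesis by (simp add: field_simps)
  qed
  also have "p * (n * s / 4)\<^sup>2 / 4 = n * p * (n * s\<^sup>2) / 64"
    by (simp add: power2_eq_square)
  finally show ?case by simp
next
  case (Suc j)
  define B where "B = exp (- (n * s / 20)) + exp (- (n * p * (n * s\<^sup>2) / 64))"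
  define t where "t = exp (- (\<delta>\<^sup>2 * (n * p * l0) / 4))"
  have tB: "0 \<le> t" "0 \<le> B" by (auto simp: t_def B_def)
  have "covered_prob p (Suc (Suc j)) X L =
      rexp p (cross L X) (\<lambda>A. covered_prob p (Suc j) (X - nbrs A L X) (nbrs A L X))"
    using Suc.prems by (intro covered_prob_Suc)
  also have "\<dots> \<le> rexp p (cross L X) (\<lambda>A. of_bool ((1 + \<delta>) * (n * p * l) < card (nbrs A L X)) + (j * t + B))"
  proof (intro rexp_mono)
    fix A
    define N where "N = nbrs A L X"
    have N: "N \<subseteq> X" "finite N" using Suc.prems nbrs_subset[of A L X] finite_subset by (auto simp: N_def)
    show "covered_prob p (Suc j) (X - nbrs A L X) (nbrs A L X) \<le>
      of_bool ((1 + \<delta>) * (n * p * l) < card (nbrs A L X)) + (j * t + B)"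
    proof (cases "(1 + \<delta>) * (n * p * l) < card N")
      case True
      have "covered_prob p (Suc j) (X - N) N \<le> 1"
        using Suc.prems N p by (intro covered_prob_le_1) auto
      moreover have "0 \<le> j * t + B" using tB by auto
      ultimately show ?thesis using True by (simp add: N_def)
    next
      case False
      then have cN: "card N \<le> a * l" by (simp add: a_def mult_ac)
      have l0: "0 \<le> l" using Suc.prems by linarith
      then have al: "2 * l \<le> a * l" using a by (intro mult_right_mono) auto
      have cXN: "real (card (X - N)) = card X - real (card N)"
        using N Suc.prems by (simp add: card_Diff_subset card_mono of_nat_diff)
      have "covered_prob p (Suc j) (X - N) N \<le> j * t + B"
        unfolding t_def B_def
      proof (intro Suc.IH[of "a * l"])
        show "n / 2 + 2 * a ^ j * (a * l) - 2 * (a * l) \<le> real (card (X - N))"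
          using Suc.prems(11) al cN unfolding cXN
          by (simp add: mult.assoc mult.left_commute)
        show "card (X - N) \<le> n"
          using Suc.prems(4,10) card_mono[of X "X - N"] by auto
        show "s \<le> (1 - p) powr (a ^ j * (a * l))"
          using Suc.prems(3) by (simp add: mult.assoc mult.left_commute)
        show "l0 \<le> a * l" using Suc.prems(9) al l0 by linarith
        show "finite (X - N)" "finite N" "N \<inter> (X - N) = {}" using Suc.prems(4) N by auto
      qed (use Suc.prems(1,2,8) cN in simp_all)
      then show ?thesis using False by (simp add: N_def)
    qed
  qed (use p in auto)
  also have "\<dots> \<le> exp (- (\<delta>\<^sup>2 * (n * p * l) / 4)) + (j * t + B)"
    unfolding rexp_add
  proof (intro add_mono nbrs_card_upper_tail)
    have "real (card L) * real (card X) \<le> l * n"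
      using Suc.prems by (intro mult_mono) auto
    then have "p * (real (card L) * real (card X)) \<le> p * (l * n)"
      using p by (intro mult_left_mono) auto
    then show "p * card L * card X \<le> n * p * l" by (simp add: mult_ac)
  qed (use Suc.prems p \<delta> in \<open>auto simp: rexp_const\<close>)
  also have "exp (- (\<delta>\<^sup>2 * (n * p * l) / 4)) \<le> t"
    using Suc.prems p unfolding t_def by (auto intro!: mult_left_mono)
  finally show ?case unfolding t_def[symmetric] B_def[symmetric] by (simp add: algebra_simps)
qed

section \<open>Union bound over maximal matchings\<close>

lemma k_matching_subset: "k_matching k E M \<Longrightarrow> N \<subseteq> M \<Longrightarrow> k_matching k E N"
  unfolding k_matching_def by (meson subsetD subset_trans)

lemma is_path_rev: "is_path E u xs v \<Longrightarrow> is_path E v (rev xs) u"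
  by (simp add: is_path_def hd_rev last_rev insert_commute)

lemma graph_dist_commute: "graph_dist E u v = graph_dist E v u"
proof -
  have "graph_dist E u v \<le> graph_dist E v u" for u v
    unfolding graph_dist_def
  proof (rule INF_greatest)
    fix xs assume "xs \<in> {xs. is_path E v xs u}"
    then show "(INF xs\<in>{xs. is_path E u xs v}. enat (length xs - 1)) \<le> enat (length xs - 1)"
      by (intro INF_lower2[of "rev xs"]) (auto intro: is_path_rev)
  qed
  then show ?thesis by (simp add: antisym)
qed

text \<open>An edge among the unreached vertices has both ends at distance at least \<open>k\<close>
  from all vertices of \<open>M\<close>, so adding it to \<open>M\<close> would give a larger
  \<open>k\<close>-matching.\<close>

lemma maximum_k_matching_covers:
  assumes "1 \<le> k" "E \<subseteq> pairs V" "finite V" and M: "k_matching k E M"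
    and max: "\<And>M'. k_matching k E M' \<Longrightarrow> card M' \<le> card M"
  shows "edgeless E (unreached (k - 1) (V - \<Union>M) (\<Union>M) E)"
proof (rule ccontr)
  define X where "X = V - \<Union>M"
  assume "\<not> edgeless E (unreached (k - 1) (V - \<Union>M) (\<Union>M) E)"
  then obtain e where e: "e \<in> E" "e \<subseteq> unreached (k - 1) X (\<Union>M) E" "card e = 2"
    unfolding edgeless_def pairs_def X_def by blast
  have eX: "e \<subseteq> X" using e(2) unreached_subset[of "k - 1" X "\<Union>M" E] by simp
  have far: "u \<noteq> v \<and> enat k \<le> graph_dist E v u" if "u \<in> e" "v \<in> \<Union>M" for u v
  proof
    show "u \<noteq> v" using that eX by (auto simp: X_def)
    show "enat k \<le> graph_dist E v u"
      unfolding graph_dist_def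
    proof (rule INF_greatest)
      fix xs assume "xs \<in> {xs. is_path E v xs u}"
      then have xs: "xs \<noteq> []" "hd xs = v" "last xs = u" "successively (\<lambda>x y. {x, y} \<in> E) xs"
        by (auto simp: is_path_def)
      \<comment> \<open>\<open>length xs\<close> counts vertices: more than \<open>k\<close>
        vertices mean at least \<open>k\<close> edges, which is why \<open>k - 1\<close> layers
        suffice.\<close>
      have "length xs > Suc (k - 1)"
      proof (rule unreached_walk)
        show "u \<in> unreached (k - 1) X (\<Union>M) E" using e that by auto
        show "{u, v} \<notin> E" if "u \<notin> X" "u \<notin> \<Union>M" "v \<in> X" for u v
          using that assms(2) by (auto simp: X_def pairs_def)
        show "hd xs \<notin> X" using xs(2) that by (auto simp: X_def)
      qed (use xs in simp_all)
      then show "enat k \<le> enat (length xs - 1)" using assms(1) by simp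
    qed
  qed
  have "e \<notin> M" 
  proof
    assume "e \<in> M"
    then have "e = {}" using eX by (auto simp: X_def)
    then show False using e by simp
  qed
  moreover have "finite M"
    using M assms(2,3) finite_subset[of M "pairs V"] by (auto simp: k_matching_def)
  ultimately have "card (insert e M) = Suc (card M)" by simp
  moreover have "k_matching k E (insert e M)"
    unfolding k_matching_def
  proof (intro conjI ballI impI)
    show "insert e M \<subseteq> E" using M e by (auto simp: k_matching_def)
  next
    fix f g u v assume *: "f \<in> insert e M" "g \<in> insert e M" "f \<noteq> g" "u \<in> f" "v \<in> g"
    then consider "f \<in> M" "g \<in> M" | "f = e" "g \<in> M" | "f \<in> M" "g = e" by blast
    then have "u \<noteq> v \<and> enat k \<le> graph_dist E u v"
    proof cases
      case 1
      then show ?thesis using M * unfolding k_matching_def by blast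
    next
      case 2
      then have "u \<in> e" "v \<in> \<Union>M" using * by auto
      from far[OF this] show ?thesis by (subst graph_dist_commute)
    next
      case 3
      then have "v \<in> e" "u \<in> \<Union>M" using * by auto
      from far[OF this] show ?thesis by blast
    qed
    then show "u \<noteq> v" "enat k \<le> graph_dist E u v" by auto
  qed
  ultimately show False using max[of "insert e M"] by simp
qed

text \<open>The edges of \<open>M\<close> lie inside \<open>\<Union>M\<close>, whereas the covering
  event reads only edges with an end outside it. The two sets of edges are disjoint, so the
  expectation factorizes; all other edges are integrated out.\<close>

lemma rexp_subset_covers:
  assumes "finite V" "M \<subseteq> pairs V"
  shows "rexp p (pairs V) (\<lambda>E. of_bool (M \<subseteq> E) * of_bool (edgeless E (unreached j (V - \<Union>M) (\<Union>M) E)))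
    = p ^ card M * covered_prob p j (V - \<Union>M) (\<Union>M)"
proof -
  define U where "U = \<Union>M"
  define G where "G = cross U (V - U) \<union> pairs (V - U)"
  have U: "U \<subseteq> V" using assms by (auto simp: U_def pairs_def)
  have G: "G \<subseteq> pairs V"
    unfolding G_def using U by (intro Un_least cross_subset_pairs pairs_mono) auto
  have "e \<notin> M" if "e \<in> G" for e
  proof -
    have "\<exists>v\<in>e. v \<notin> U" using that by (auto simp: G_def in_cross pairs_def card_2_iff)
    then show ?thesis by (auto simp: U_def)
  qed
  then have MG: "M \<inter> G = {}" by blast
  have fin: "finite M" "finite G"
    using finite_subset[OF assms(2)] finite_subset[OF G] assms(1) by simp_all
  have "rexp p (pairs V) (\<lambda>E. of_bool (M \<subseteq> E) * of_bool (edgeless E (unreached j (V - U) U E)))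
    = rexp p (pairs V) (\<lambda>E. (\<lambda>E'. of_bool (M \<subseteq> E') * of_bool (edgeless (E' \<inter> G) (unreached j (V - U) U (E' \<inter> G))))
        (E \<inter> (M \<union> G)))"
  proof (intro rexp_cong)
    fix E
    have "edgeless E (unreached j (V - U) U E) \<longleftrightarrow>
      edgeless (E \<inter> (M \<union> G) \<inter> G) (unreached j (V - U) U (E \<inter> (M \<union> G) \<inter> G))"
      by (intro edgeless_unreached_cong) (auto simp: G_def)
    then show "of_bool (M \<subseteq> E) * of_bool (edgeless E (unreached j (V - U) U E)) =
      (\<lambda>E'. of_bool (M \<subseteq> E') * of_bool (edgeless (E' \<inter> G) (unreached j (V - U) U (E' \<inter> G))) :: real)
        (E \<inter> (M \<union> G))" by simp
  qed
  also have "\<dots> = rexp p (M \<union> G) (\<lambda>E'. of_bool (M \<subseteq> E') * of_bool (edgeless (E' \<inter> G) (unreached j (V - U) U (E' \<inter> G))))"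
    using assms G by (intro rexp_Int) auto
  also have "\<dots> = rexp p M (\<lambda>A. rexp p G (\<lambda>B. of_bool (M \<subseteq> A) * of_bool (edgeless B (unreached j (V - U) U B))))"
    unfolding rexp_Un[OF fin MG]
  proof (intro rexp_cong)
    fix A B assume AB: "A \<subseteq> M" "B \<subseteq> G"
    then have "(A \<union> B) \<inter> G = B" "M \<subseteq> A \<union> B \<longleftrightarrow> M \<subseteq> A" using MG by auto
    then show "of_bool (M \<subseteq> A \<union> B) * of_bool (edgeless ((A \<union> B) \<inter> G) (unreached j (V - U) U ((A \<union> B) \<inter> G)))
      = (of_bool (M \<subseteq> A) * of_bool (edgeless B (unreached j (V - U) U B)) :: real)" by simp
  qed
  also have "\<dots> = p ^ card M * covered_prob p j (V - U) U"
    unfolding rexp_cmult rexp_multc rexp_superset[OF fin(1)] covered_prob_def G_def ..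
  finally show ?thesis by (simp add: U_def)
qed

text \<open>The factor \<open>y\<close> to the power \<open>card M - m\<close> is at least 1 for \<open>card M < m\<close>; inserting it extends the
  union bound to a sum over all \<open>M\<close>, which factorizes.\<close>

lemma prob_no_k_matching_le:
  fixes p q y :: real
  assumes V: "finite V" and k: "1 \<le> k" and p: "0 \<le> p" "p \<le> 1" and y: "0 < y" "y \<le> 1" and "0 \<le> q"
    and q: "\<And>U. U \<subseteq> V \<Longrightarrow> card U \<le> 2 * m \<Longrightarrow> covered_prob p (k - 1) (V - U) U \<le> q"
  shows "rexp p (pairs V) (\<lambda>E. of_bool (\<nexists>M. k_matching k E M \<and> card M = m))
    \<le> q / y ^ m * (1 + p * y) ^ card (pairs V)"
proof -
  define F where "F = pairs V"
  have F: "finite F" using V by (simp add: F_def)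
  define b :: "'a set set \<Rightarrow> 'a set set \<Rightarrow> real" where
    "b M E = of_bool (M \<subseteq> E) * of_bool (edgeless E (unreached (k - 1) (V - \<Union>M) (\<Union>M) E))" for M E
  have b0: "0 \<le> b M E" for M E by (simp add: b_def)
  have "rexp p F (\<lambda>E. of_bool (\<nexists>M. k_matching k E M \<and> card M = m))
    \<le> rexp p F (\<lambda>E. \<Sum>M\<in>Pow F. of_bool (card M < m) * b M E)"
  proof (intro rexp_mono p)
    fix E assume E: "E \<subseteq> F"
    \<comment> \<open>A maximum \<open>k\<close>-matching has fewer than \<open>m\<close> edges,
      since otherwise a subset of it would be a \<open>k\<close>-matching with exactly
      \<open>m\<close>. It therefore contributes a summand equal to 1.\<close>
    have "1 \<le> (\<Sum>M\<in>Pow F. of_bool (card M < m) * b M E)" if no: "\<nexists>M. k_matching k E M \<and> card M = m"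
    proof -
      define P where "P M \<longleftrightarrow> k_matching k E M" for M
      have "P {}" by (simp add: P_def k_matching_def)
      moreover have "\<forall>M. P M \<longrightarrow> card M < Suc (card F)"
        using E F by (auto simp: P_def k_matching_def less_Suc_eq_le intro!: card_mono)
      ultimately obtain M where M: "P M" "\<And>M'. P M' \<Longrightarrow> card M' \<le> card M"
        using ex_has_greatest_nat[of P "{}" card] by blast
      have MF: "M \<subseteq> E" using M by (auto simp: P_def k_matching_def)
      have "card M < m"
      proof (rule ccontr)
        assume "\<not> card M < m"
        then obtain N where "N \<subseteq> M" "card N = m" by (meson not_less obtain_subset_with_card_n)
        then show False using no M(1) k_matching_subset[of k E M N] by (auto simp: P_def)
      qed
      moreover have "edgeless E (unreached (k - 1) (V - \<Union>M) (\<Union>M) E)"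
        using M E V k by (intro maximum_k_matching_covers) (auto simp: P_def F_def)
      ultimately have "1 = of_bool (card M < m) * b M E" using MF by (simp add: b_def)
      also have "\<dots> \<le> (\<Sum>M\<in>Pow F. of_bool (card M < m) * b M E)"
        using MF E F b0 by (intro member_le_sum) auto
      finally show ?thesis .
    qed
    then show "of_bool (\<nexists>M. k_matching k E M \<and> card M = m) \<le> (\<Sum>M\<in>Pow F. of_bool (card M < m) * b M E)"
      using b0 by (auto intro!: sum_nonneg)
  qed
  also have "\<dots> = (\<Sum>M\<in>Pow F. of_bool (card M < m) * (p ^ card M * covered_prob p (k - 1) (V - \<Union>M) (\<Union>M)))"
    unfolding rexp_sum rexp_cmult b_def F_def using V by (intro sum.cong) (auto simp: rexp_subset_covers)
  also have "\<dots> \<le> (\<Sum>M\<in>Pow F. q / y ^ m * (p * y) ^ card M)"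
  proof (intro sum_mono)
    fix M assume M: "M \<in> Pow F"
    show "of_bool (card M < m) * (p ^ card M * covered_prob p (k - 1) (V - \<Union>M) (\<Union>M))
        \<le> q / y ^ m * (p * y) ^ card M"
    proof (cases "card M < m")
      case True
      have "card (\<Union>M) \<le> sum card M" by (rule card_Union_le_sum_card)
      also have "\<dots> = 2 * card M" using M by (simp add: F_def pairs_def subset_iff)
      finally have "covered_prob p (k - 1) (V - \<Union>M) (\<Union>M) \<le> q"
        using M True by (intro q) (auto simp: F_def pairs_def)
      moreover have "1 \<le> y ^ card M / y ^ m"
        using y True power_decreasing[of "card M" m y] by simp
      ultimately have "p ^ card M * covered_prob p (k - 1) (V - \<Union>M) (\<Union>M) * 1
          \<le> p ^ card M * q * (y ^ card M / y ^ m)"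
        using p \<open>0 \<le> q\<close> by (intro mult_mono) (auto simp: covered_prob_nonneg)
      then show ?thesis using True by (simp add: power_mult_distrib mult_ac)
    next
      case False
      then show ?thesis using p y \<open>0 \<le> q\<close> by simp
    qed
  qed
  also have "\<dots> = q / y ^ m * (1 + p * y) ^ card F"
    by (simp only: sum_distrib_left[symmetric] sum_Pow_power_card[OF F])
  finally show ?thesis by (simp add: F_def)
qed

section \<open>Choice of parameters\<close>

text \<open>All exponents are measured in units of \<open>k * m * ln d\<close>. Conditions
  \<open>e1\<close> to \<open>e3\<close> make each of the \<open>k\<close> error terms of the
  exploration at most exp of -3 units; the weight \<open>y\<close> and the sum over all
  \<open>M\<close> cost one unit each, the latter by \<open>e4\<close>. One unit is left
  over.\<close>

lemma no_k_matching_exp_bound: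
  fixes p d \<delta> s :: real and n m k :: nat
  assumes k: "2 \<le> k" and p: "0 \<le> p" "p < 1" and d: "d = n * p" "1 \<le> d"
    and \<delta>: "0 < \<delta>" "\<delta> \<le> 1" "2 \<le> (1 + \<delta>) * d"
    and s: "0 < s" "8 \<le> n * s" "s \<le> (1 - p) powr (((1 + \<delta>) * d) ^ (k - 2) * (2 * m))"
    and size: "4 * m * ((1 + \<delta>) * d) ^ (k - 2) \<le> n / 2"
    and e1: "3 * k * m * ln d \<le> \<delta>\<^sup>2 * (d * (2 * m)) / 4"
    and e2: "3 * k * m * ln d \<le> n * s / 20"
    and e3: "3 * k * m * ln d \<le> d * (n * s\<^sup>2) / 64"
    and e4: "n / d ^ (k - 1) \<le> 2 * k * m * ln d"
  shows "rexp p (pairs {1..n}) (\<lambda>E. of_bool (\<nexists>M. k_matching k E M \<and> card M = m)) \<le> k * exp (- (k * m * ln d))"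
proof -
  define q where "q = k * exp (- (3 * k * m * ln d))"
  \<comment> \<open>This balances the two costs: \<open>1 / y ^ m\<close> is exp of one unit, and
    the sum over \<open>M\<close> is at most exp (n^2 p y/2), which equals exp (n / (2
    d^(k-1))).\<close>
  define y where "y = 1 / d ^ k"
  have cov: "covered_prob p (k - 1) ({1..n} - U) U \<le> q" if U: "U \<subseteq> {1..n}" "card U \<le> 2 * m" for U
  proof -
    have fin: "finite U" using U finite_subset by blast
    have cU: "real (card ({1..n} - U)) = n - real (card U)"
      using U fin card_mono[of "{1..n}" U] by (simp add: card_Diff_subset of_nat_diff)
    have "covered_prob p (Suc (k - 2)) ({1..n} - U) U \<le> (k - 2) * exp (- (\<delta>\<^sup>2 * (n * p * real (2 * m)) / 4))
      + (exp (- (n * s / 20)) + exp (- (n * p * (n * s\<^sup>2) / 64)))"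
    proof (rule covered_prob_le[where l = "real (2 * m)"])
      show "n / 2 + 2 * ((1 + \<delta>) * (n * p)) ^ (k - 2) * real (2 * m) - 2 * real (2 * m) \<le> real (card ({1..n} - U))"
        using size U unfolding cU d by (simp add: mult_ac)
      show "card ({1..n} - U) \<le> n" using card_mono[of "{1..n}" "{1..n} - U"] by simp
    qed (use p \<delta> s d fin U in auto)
    also have "\<dots> \<le> (k - 2) * exp (- (3 * k * m * ln d)) + (exp (- (3 * k * m * ln d)) + exp (- (3 * k * m * ln d)))"
      using e1 e2 e3 unfolding d(1) by (intro add_mono mult_left_mono) auto
    also have "\<dots> = q" using k by (simp add: q_def of_nat_diff algebra_simps)
    also have "Suc (k - 2) = k - 1" using k by simp
    finally show ?thesis .
  qed
  have "rexp p (pairs {1..n}) (\<lambda>E. of_bool (\<nexists>M. k_matching k E M \<and> card M = m))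
    \<le> q / y ^ m * (1 + p * y) ^ card (pairs {1..n})"
    using k p d cov by (intro prob_no_k_matching_le) (auto simp: y_def q_def)
  also have "\<dots> \<le> q / y ^ m * exp (k * m * ln d)"
  proof (intro mult_left_mono)
    have y0: "0 \<le> p * y" using p d by (simp add: y_def)
    have "(1 + p * y) ^ card (pairs {1..n}) \<le> exp (p * y) ^ card (pairs {1..n})"
      using y0 by (intro power_mono exp_ge_add_one_self) auto
    also have "\<dots> = exp (real (card (pairs {1..n})) * (p * y))"
      by (simp only: exp_of_nat_mult)
    also have "\<dots> \<le> exp (real n * real n / 2 * (p * y))"
    proof -
      have "real (card (pairs {1..n})) \<le> real n * real n / 2"
        unfolding card_pairs[OF finite_atLeastAtMost] by (simp add: algebra_simps)
      from mult_right_mono[OF this y0] show ?thesis by simp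
    qed
    also have "real n * real n / 2 * (p * y) = n / d ^ (k - 1) / 2"
    proof -
      have "real n * real n / 2 * (p * y) = n * d * y / 2" by (simp add: d(1))
      also have "d ^ k = d * d ^ (k - 1)" using k by (cases k) auto
      then have "d * y = 1 / d ^ (k - 1)" using d(2) by (simp add: y_def)
      then have "n * d * y / 2 = n / d ^ (k - 1) / 2" by (simp add: mult.assoc)
      finally show ?thesis .
    qed
    also have "exp (n / d ^ (k - 1) / 2) \<le> exp (k * m * ln d)" using e4 by simp
    finally show "(1 + p * y) ^ card (pairs {1..n}) \<le> exp (k * m * ln d)" .
    show "0 \<le> q / y ^ m" using d by (simp add: q_def y_def)
  qed
  also have "q / y ^ m = k * exp (- (3 * k * m * ln d)) * exp (k * m * ln d)"
  proof -
    have "d ^ (k * m) = exp (real (k * m) * ln d)"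
      using d(2) by (simp add: exp_of_nat_mult del: of_nat_mult)
    then show ?thesis by (simp add: q_def y_def power_divide power_mult[symmetric])
  qed
  also have "\<dots> * exp (k * m * ln d) = k * exp (- (k * m * ln d))"
    unfolding mult.assoc exp_add[symmetric] by simp
  finally show ?thesis .
qed

text \<open>The last hypothesis amounts to 1/(1 - p) <= 1 + \<delta>, and ln x <= x - 1 at x = 1/(1
  - p) gives -ln (1 - p) <= p/(1 - p).\<close>

lemma ln_one_minus_ge:
  fixes p \<delta> :: real
  assumes "0 \<le> p" "0 < \<delta>" "p * (1 + \<delta>) \<le> \<delta>"
  shows "- ((1 + \<delta>) * p) \<le> ln (1 - p)"
proof -
  have "p < 1" using assms mult_left_mono[of 1 p "1 + \<delta>"] by (simp add: algebra_simps) (smt (verit) mult_less_cancel_right2)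
  have "ln (1 / (1 - p)) \<le> 1 / (1 - p) - 1" using \<open>p < 1\<close> by (intro ln_le_minus_one) auto
  also have "\<dots> = p * (1 / (1 - p))" using \<open>p < 1\<close> by (simp add: field_simps)
  also have "\<dots> \<le> p * (1 + \<delta>)" using \<open>p < 1\<close> assms by (intro mult_left_mono) (auto simp: field_simps)
  finally show ?thesis using \<open>p < 1\<close> by (simp add: ln_div mult.commute)
qed

text \<open>Verifies the numerical conditions of \<open>no_k_matching_exp_bound\<close>. They reduce
  to conditions on \<open>d\<close> alone, true once \<open>d\<close> is large, and to lower bounds
  on \<open>R\<close>, which tends to infinity in the application.\<close>

lemma no_k_matching_small:
  fixes p d \<epsilon> \<delta> R T :: real and n m k :: nat
  defines "R \<equiv> n / d ^ (k - 1)" and "T \<equiv> k * n * ln d / (4 * d ^ (k - 1))"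
  assumes k: "2 \<le> k" and \<epsilon>: "0 < \<epsilon>" "\<epsilon> \<le> 1 / 2" and p: "0 \<le> p" and d: "d = n * p"
    and \<delta>: "0 < \<delta>" "\<delta> \<le> 1" "(1 + \<delta>) ^ (k - 1) * (1 - \<epsilon> / 2) \<le> 1 - \<epsilon> / 4"
    and d2: "2 \<le> d" and ln1: "1 \<le> ln d" and d\<eta>: "48 * k\<^sup>2 * (ln d)\<^sup>2 \<le> d powr (\<epsilon> / 4)"
    and d\<delta>: "6 * k * ln d \<le> \<delta>\<^sup>2 * d" and dk: "2 ^ (k + 1) * k * ln d \<le> d"
    and R: "8 \<le> R" "(1 + \<delta>) / \<delta> \<le> R"
    and m: "(1 - \<epsilon>) * T \<le> m" "m \<le> (1 - \<epsilon> / 2) * T"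
  shows "rexp p (pairs {1..n}) (\<lambda>E. of_bool (\<nexists>M. k_matching k E M \<and> card M = m)) \<le> k * exp (- (R / 4))"
proof -
  define \<eta> where "\<eta> = \<epsilon> / 4"
  \<comment> \<open>Slightly above the critical value d^(-k/2): both n s and d n s^2 are then at
    least R d^\<eta>, while \<open>k * m * ln d\<close> is only of order R (ln d)^2.\<close>
  define s where "s = d powr (- ((1 - \<eta>) * k / 2))"
  have dpos: "0 < d" and npos: "0 < real n" using d2 d by (auto intro: Nat.gr0I)
  have T: "T = k * R * ln d / 4" by (simp add: T_def R_def)
  have T0: "0 \<le> T" using R ln1 by (simp add: T)
  have nR: "n = R * d ^ (k - 1)" using dpos by (simp add: R_def)
  obtain j where "k = 2 + j" using k by (metis le_iff_add)
  then have j: "k = Suc (Suc j)" by simp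
  have pn: "p = d / n" using d npos by simp
  \<comment> \<open>Since p R = d^(-(k-2)), a large \<open>R\<close> by itself forces
    \<open>p\<close> to be small.\<close>
  have pR: "p * R \<le> 1"
  proof -
    have "p * R = 1 / d ^ (k - 2)" using npos dpos by (simp add: pn R_def j)
    then show ?thesis using d2 by (simp add: one_le_power)
  qed
  have p\<delta>: "p * (1 + \<delta>) \<le> \<delta>"
  proof -
    have "p * ((1 + \<delta>) / \<delta>) \<le> p * R" using R p by (intro mult_left_mono)
    then have "p * (1 + \<delta>) / \<delta> \<le> 1" using pR by simp
    then show ?thesis using \<delta>(1) by (simp add: divide_le_eq)
  qed
  have p1: "p < 1"
  proof -
    have "p * 8 \<le> p * R" using R p by (intro mult_left_mono)
    then show ?thesis using pR by simp
  qed
  have mT: "m \<le> T" using m(2) T0 \<epsilon> mult_right_mono[of "1 - \<epsilon> / 2" 1 T] by simp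
  have klm: "3 * k * m * ln d \<le> 3 / 4 * (k\<^sup>2 * (ln d)\<^sup>2 * R)"
  proof -
    have "3 * k * ln d * m \<le> 3 * k * ln d * T" using mT ln1 by (intro mult_left_mono) auto
    then show ?thesis by (simp add: T power2_eq_square mult_ac)
  qed
  have m_ge: "k * R * ln d / 8 \<le> m"
  proof -
    have "1 / 2 * T \<le> (1 - \<epsilon>) * T" using \<epsilon> T0 by (intro mult_right_mono) auto
    then have "T / 2 \<le> m" using m(1) by linarith
    then show ?thesis by (simp add: T)
  qed
  have k2: "2 \<le> real k" using k by simp
  have dn: "d powr (real k - 1) = d ^ (k - 1)" using dpos k by (simp add: powr_realpow[symmetric] of_nat_diff)
  have ns: "R * d powr \<eta> \<le> n * s"
  proof -
    have "n * s = R * d powr ((k - 1) + (- ((1 - \<eta>) * k / 2)))"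
      unfolding powr_add s_def using dn k by (simp add: nR of_nat_diff)
    \<comment> \<open>The right side exceeds the left by (k - 2)(1 + \<eta>)/2.\<close>
    moreover have "\<eta> \<le> (k - 1) + (- ((1 - \<eta>) * k / 2))"
    proof -
      have "0 \<le> (real k - 2) * (1 + \<eta>)" using k2 \<epsilon> by (intro mult_nonneg_nonneg) (auto simp: \<eta>_def)
      then show ?thesis using k by (simp add: of_nat_diff field_simps)
    qed
    ultimately show ?thesis using R d2 by (auto intro!: mult_left_mono powr_mono)
  qed
  have dns: "R * d powr \<eta> \<le> d * (n * s\<^sup>2)"
  proof -
    have s2: "s\<^sup>2 = d powr (- ((1 - \<eta>) * k))"
      unfolding s_def power2_eq_square powr_add[symmetric] by (simp add: mult.commute)
    have "d * (n * s\<^sup>2) = R * (d powr 1 * d powr (k - 1) * d powr (- ((1 - \<eta>) * k)))"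
      unfolding s2 using dn dpos k by (simp add: nR of_nat_diff)
    also have "\<dots> = R * d powr (\<eta> * k)"
      unfolding powr_add[symmetric] using k by (simp add: of_nat_diff algebra_simps)
    finally have eq: "d * (n * s\<^sup>2) = R * d powr (\<eta> * k)" .
    have "\<eta> * 1 \<le> \<eta> * k" using k \<epsilon> by (intro mult_left_mono) (auto simp: \<eta>_def)
    then show ?thesis unfolding eq using R d2 by (auto intro!: mult_left_mono powr_mono)
  qed
  \<comment> \<open>The constant is 48 = 64 * 3/4: the 3/4 stems from \<open>klm\<close> and the 64
    from the exponent d n s^2/64. The condition with n s/20 is weaker.\<close>
  have big: "48 * (k\<^sup>2 * (ln d)\<^sup>2 * R) \<le> R * d powr \<eta>"
    using mult_left_mono[OF d\<eta>, of R] R by (simp add: \<eta>_def mult_ac)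
  have pos: "0 \<le> k\<^sup>2 * (ln d)\<^sup>2 * R" using R by simp
  have "rexp p (pairs {1..n}) (\<lambda>E. of_bool (\<nexists>M. k_matching k E M \<and> card M = m)) \<le> k * exp (- (k * m * ln d))"
  proof (rule no_k_matching_exp_bound[where s = s and \<delta> = \<delta>])
    show "1 \<le> d" "0 < s" "p < 1" using d2 p1 by (auto simp: s_def)
    show "2 \<le> (1 + \<delta>) * d" using d2 \<delta> mult_mono[of 1 "1 + \<delta>" 2 d] by simp
    have "1 \<le> d powr \<eta>" using d2 \<epsilon> by (intro ge_one_powr_ge_zero) (auto simp: \<eta>_def)
    then have "R * 1 \<le> R * d powr \<eta>" using R by (intro mult_left_mono) auto
    then show "8 \<le> n * s" using ns R by linarith
    \<comment> \<open>This is where the factor k/4 in the target size is decided. Using m <= (1 -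
      \<epsilon>/2) T, the exponent of 1/s needed is at most (1 + \<delta>)^(k-1) (1 - \<epsilon>/2)
      (k/2) ln d; \<open>k - 2\<close> of the factors 1 + \<delta> come from layer growth and one
      from replacing -ln (1 - p) by p. The choice of \<delta> turns the product into 1 -
      \<eta>.\<close>
    show "s \<le> (1 - p) powr (((1 + \<delta>) * d) ^ (k - 2) * (2 * m))"
    proof -
      let ?z = "((1 + \<delta>) * d) ^ (k - 2) * (2 * m)"
      have z0: "0 \<le> ?z" using \<delta> dpos by simp
      have "?z * ((1 + \<delta>) * p) = (1 + \<delta>) ^ (k - 1) * (d ^ (k - 2) * p * 2 * m)"
        by (simp add: j power_mult_distrib mult_ac)
      also have "\<dots> \<le> (1 + \<delta>) ^ (k - 1) * (d ^ (k - 2) * p * 2 * ((1 - \<epsilon> / 2) * T))"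
        using m(2) \<delta> dpos p by (intro mult_left_mono) auto
      also have "d ^ (k - 2) * p * 2 * ((1 - \<epsilon> / 2) * T) = (1 - \<epsilon> / 2) * (k / 2 * ln d)"
        using dpos npos by (simp add: T_def j pn field_simps)
      also have "(1 + \<delta>) ^ (k - 1) * ((1 - \<epsilon> / 2) * (k / 2 * ln d)) = ((1 + \<delta>) ^ (k - 1) * (1 - \<epsilon> / 2)) * (k / 2 * ln d)"
        by simp
      also have "\<dots> \<le> (1 - \<eta>) * (k / 2 * ln d)"
        using \<delta>(3) ln1 by (intro mult_right_mono) (auto simp: \<eta>_def)
      finally have "- ((1 - \<eta>) * k / 2) * ln d \<le> ?z * (- ((1 + \<delta>) * p))" by simp
      also have "\<dots> \<le> ?z * ln (1 - p)"
        using z0 ln_one_minus_ge[OF p \<delta>(1) p\<delta>] by (rule mult_left_mono[rotated])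
      finally show ?thesis using dpos p1 by (simp add: s_def powr_def)
    qed
    show "4 * m * ((1 + \<delta>) * d) ^ (k - 2) \<le> n / 2"
    proof -
      have "(1 + \<delta>) ^ (k - 2) \<le> 2 ^ (k - 2)" using \<delta> by (intro power_mono) auto
      then have "4 * m * ((1 + \<delta>) * d) ^ (k - 2) \<le> 4 * T * (2 ^ (k - 2) * d ^ (k - 2))"
        unfolding power_mult_distrib using mT dpos \<delta> by (intro mult_mono) auto
      also have "\<dots> = (2 ^ (k - 2) * k * ln d / d) * n"
        using dpos by (simp add: T_def j field_simps)
      also have "\<dots> \<le> 1 / 2 * n"
      proof (intro mult_right_mono)
        have "2 ^ (k + 1) = (8 :: real) * 2 ^ (k - 2)" using k by (simp flip: power_add add: power_diff)
        moreover have "0 \<le> 2 ^ (k - 2) * k * ln d" using ln1 by simp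
        ultimately have "2 * (2 ^ (k - 2) * k * ln d) \<le> d" using dk by simp
        then show "2 ^ (k - 2) * k * ln d / d \<le> 1 / 2" using dpos by (simp add: field_simps)
      qed simp
      finally show ?thesis by simp
    qed
    show "3 * k * m * ln d \<le> \<delta>\<^sup>2 * (d * (2 * m)) / 4"
      using mult_right_mono[OF d\<delta>, of m] by (simp add: algebra_simps)
    show "3 * k * m * ln d \<le> n * s / 20" using klm big ns pos by linarith
    show "3 * k * m * ln d \<le> d * (n * s\<^sup>2) / 64" using klm big dns pos by linarith
    show "n / d ^ (k - 1) \<le> 2 * k * m * ln d"
    proof -
      have "1 * 1 \<le> (real k / 2)\<^sup>2 * (ln d)\<^sup>2"
        using k2 ln1 by (intro mult_mono one_le_power) auto
      then have "R * 1 \<le> R * ((real k / 2)\<^sup>2 * (ln d)\<^sup>2)" using R by (intro mult_left_mono) auto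
      also have "\<dots> = 2 * k * ln d * (k * R * ln d / 8)" by (simp add: power2_eq_square)
      also have "\<dots> \<le> 2 * k * ln d * m" using m_ge ln1 by (intro mult_left_mono) auto
      finally show ?thesis by (simp add: R_def mult_ac)
    qed
  qed (use k p d \<delta> in auto)
  also have "\<dots> \<le> k * exp (- (R / 4))"
  proof -
    have "2 * R * 1 \<le> k * R * ln d" using k2 R ln1 by (intro mult_mono) auto
    then have "R / 4 \<le> m" using m_ge by simp
    moreover have "1 * real m * 1 \<le> real k * real m * ln d" using k2 ln1 by (intro mult_mono) auto
    ultimately show ?thesis by (auto intro!: mult_left_mono)
  qed
  finally show ?thesis .
qed

section \<open>Order of the constants and passage to the limit\<close>

theorem theorem1p3:
  fixes k :: nat
  assumes "k \<ge> 2"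
  shows "\<forall>\<epsilon>::real. \<epsilon> > 0 \<longrightarrow> (\<exists>c::real. c > 0 \<and>
    (\<forall>(p :: nat \<Rightarrow> real) (d :: nat \<Rightarrow> real).
       (\<forall>n. 0 \<le> p n \<and> p n \<le> 1) \<longrightarrow>
       (\<forall>n. d n = real n * p n) \<longrightarrow>
       (\<forall>\<^sub>F n in sequentially. d n \<ge> c) \<longrightarrow>
       (\<lambda>n. d n ^ (k - 1)) \<in> o(\<lambda>n. real n) \<longrightarrow>
       (\<lambda>n. measure_pmf.prob (gnp n (p n))
          {E. \<exists>M. k_matching k E M \<and>
             (1 - \<epsilon>) * (real k * real n * ln (d n) / (4 * d n ^ (k - 1))) \<le> real (card M) \<and>
             real (card M) \<le> (1 + \<epsilon>) * (real k * real n * ln (d n) / (4 * d n ^ (k - 1)))})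
         \<longlonglongrightarrow> 1))"
proof (intro allI impI)
  fix \<epsilon>' :: real assume "\<epsilon>' > 0"
  \<comment> \<open>Shrinking the tolerance only strengthens the claim, and \<epsilon> <= 1/2 keeps
    the size at least T/2.\<close>
  define \<epsilon> where "\<epsilon> = min \<epsilon>' (1 / 2)"
  have \<epsilon>: "0 < \<epsilon>" "\<epsilon> \<le> 1 / 2" "\<epsilon> \<le> \<epsilon>'" using \<open>\<epsilon>' > 0\<close> by (auto simp: \<epsilon>_def)
  have "((\<lambda>\<delta>. (1 + \<delta>) ^ (k - 1) * (1 - \<epsilon> / 2)) \<longlongrightarrow> (1 + 0) ^ (k - 1) * (1 - \<epsilon> / 2)) (at_right 0)"
    by (intro tendsto_intros)
  then have "\<forall>\<^sub>F \<delta> in at_right 0. (1 + \<delta>) ^ (k - 1) * (1 - \<epsilon> / 2) < 1 - \<epsilon> / 4"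
    using \<epsilon> by (intro order_tendstoD(2)) auto
  moreover have "\<forall>\<^sub>F \<delta> in at_right (0 :: real). \<delta> < 1" "\<forall>\<^sub>F \<delta> in at_right (0 :: real). 0 < \<delta>"
    by (auto intro: eventually_at_right_less eventually_at_rightI[of 0 1])
  ultimately have "\<forall>\<^sub>F \<delta> in at_right (0 :: real).
      0 < \<delta> \<and> \<delta> < 1 \<and> (1 + \<delta>) ^ (k - 1) * (1 - \<epsilon> / 2) < 1 - \<epsilon> / 4"
    by eventually_elim auto
  then obtain \<delta> :: real where \<delta>: "0 < \<delta>" "\<delta> < 1" "(1 + \<delta>) ^ (k - 1) * (1 - \<epsilon> / 2) < 1 - \<epsilon> / 4"
    by (auto dest!: eventually_happens)
  \<comment> \<open>These conditions involve only \<open>d\<close>, \<open>k\<close>, \<epsilon> and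
    \<delta>, so the threshold \<open>c\<close> can be fixed before the sequences \<open>p\<close>
    and \<open>d\<close> are given.\<close>
  define good where "good d \<longleftrightarrow> 2 \<le> d \<and> 1 \<le> ln d \<and> 48 * k\<^sup>2 * (ln d)\<^sup>2 \<le> d powr (\<epsilon> / 4) \<and>
    6 * k * ln d \<le> \<delta>\<^sup>2 * d \<and> 2 ^ (k + 1) * k * ln d \<le> d" for d :: real
  have "\<forall>\<^sub>F d in at_top. good d"
    unfolding good_def
  proof (intro eventually_conj)
    define A B :: real where "A = 48 * k\<^sup>2" and "B = 6 * k"
    define C :: real where "C = 2 ^ (k + 1) * k"
    have pos: "0 < A" "0 < B" "0 < C" using assms by (auto simp: A_def B_def C_def)
    show "\<forall>\<^sub>F d in at_top. (2 :: real) \<le> d" "\<forall>\<^sub>F d :: real in at_top. 1 \<le> ln d" by real_asymp+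
    show "\<forall>\<^sub>F d :: real in at_top. 48 * k\<^sup>2 * (ln d)\<^sup>2 \<le> d powr (\<epsilon> / 4)"
      unfolding A_def[symmetric] using pos \<epsilon>(1) by real_asymp
    show "\<forall>\<^sub>F d :: real in at_top. 6 * k * ln d \<le> \<delta>\<^sup>2 * d"
      unfolding B_def[symmetric] using pos \<delta>(1) by real_asymp
    show "\<forall>\<^sub>F d :: real in at_top. 2 ^ (k + 1) * k * ln d \<le> d"
      unfolding C_def[symmetric] using pos by real_asymp
  qed
  then obtain c where c: "\<And>d. c \<le> d \<Longrightarrow> good d" by (auto simp: eventually_at_top_linorder)
  show "\<exists>c::real. c > 0 \<and>
    (\<forall>(p :: nat \<Rightarrow> real) (d :: nat \<Rightarrow> real).
       (\<forall>n. 0 \<le> p n \<and> p n \<le> 1) \<longrightarrow>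
       (\<forall>n. d n = real n * p n) \<longrightarrow>
       (\<forall>\<^sub>F n in sequentially. d n \<ge> c) \<longrightarrow>
       (\<lambda>n. d n ^ (k - 1)) \<in> o(\<lambda>n. real n) \<longrightarrow>
       (\<lambda>n. measure_pmf.prob (gnp n (p n))
          {E. \<exists>M. k_matching k E M \<and>
             (1 - \<epsilon>') * (real k * real n * ln (d n) / (4 * d n ^ (k - 1))) \<le> real (card M) \<and>
             real (card M) \<le> (1 + \<epsilon>') * (real k * real n * ln (d n) / (4 * d n ^ (k - 1)))})
         \<longlonglongrightarrow> 1)"
  proof (intro exI[of _ "max c 1"] conjI allI impI)
    fix p d :: "nat \<Rightarrow> real"
    assume p: "\<forall>n. 0 \<le> p n \<and> p n \<le> 1" and d: "\<forall>n. d n = real n * p n"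
      and dc: "\<forall>\<^sub>F n in sequentially. d n \<ge> max c 1"
      and o: "(\<lambda>n. d n ^ (k - 1)) \<in> o(\<lambda>n. real n)"
    define R where "R n = n / d n ^ (k - 1)" for n
    define T where "T n = real k * real n * ln (d n) / (4 * d n ^ (k - 1))" for n
    define S where "S n = {E :: nat set set. \<exists>M. k_matching k E M \<and>
      (1 - \<epsilon>') * T n \<le> real (card M) \<and> real (card M) \<le> (1 + \<epsilon>') * T n}" for n
    have R: "filterlim R at_top sequentially"
      unfolding filterlim_at_top_gt[where c = 0]
    proof (intro allI impI)
      fix Z :: real assume "0 < Z"
      then have "\<forall>\<^sub>F n in sequentially. norm (d n ^ (k - 1)) \<le> 1 / Z * norm (real n)"
        by (intro landau_o.smallD[OF o]) simp
      then show "\<forall>\<^sub>F n in sequentially. Z \<le> R n"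
        using dc
      proof eventually_elim
        case (elim n)
        then have "0 < d n ^ (k - 1)" by simp
        then show ?case using elim \<open>0 < Z\<close> by (simp add: R_def field_simps)
      qed
    qed
    have bound: "\<forall>\<^sub>F n in sequentially. 1 - real k * exp (- (R n / 4)) \<le> measure_pmf.prob (gnp n (p n)) (S n)"
      using dc R[unfolded filterlim_at_top, rule_format, of "max (8 / \<epsilon>) (max 8 ((1 + \<delta>) / \<delta>))"]
    proof eventually_elim
      case (elim n)
      then have g: "good (d n)" by (intro c) simp
      \<comment> \<open>The lower bound 8/\<epsilon> on \<open>R n\<close> gives \<epsilon> T >= 4,
        so the interval from (1 - \<epsilon>) T to (1 - \<epsilon>/2) T has length at least 2 and
        contains the rounded-up integer \<open>m\<close>. Staying below T by the factor 1 -
        \<epsilon>/2 provides the slack that the escape estimate consumes.\<close>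
      define m where "m = nat \<lceil>(1 - \<epsilon>) * T n\<rceil>"
      have "real k * R n * ln (d n) \<ge> 2 * (8 / \<epsilon>) * 1"
        using assms elim g \<epsilon> by (intro mult_mono) (auto simp: good_def)
      moreover have "T n = real k * R n * ln (d n) / 4" by (simp add: T_def R_def)
      ultimately have T: "4 / \<epsilon> \<le> T n" by simp
      then have T0: "0 \<le> T n" using \<epsilon>(1) by (smt (verit) divide_pos_pos)
      have \<epsilon>T: "4 \<le> \<epsilon> * T n" using T \<epsilon>(1) by (simp add: field_simps)
      have "0 \<le> (1 - \<epsilon>) * T n" using T0 \<epsilon> by simp
      then have m: "(1 - \<epsilon>) * T n \<le> m" "m \<le> (1 - \<epsilon> / 2) * T n"
        using \<epsilon>T unfolding m_def by (simp_all add: algebra_simps) linarith+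
      define B where "B = {E :: nat set set. \<nexists>M. k_matching k E M \<and> card M = m}"
      have "measure_pmf.prob (gnp n (p n)) B = rexp (p n) (pairs {1..n}) (indicator B)"
        unfolding gnp_def possible_edges_eq using p by (intro prob_random_subset) auto
      also have "\<dots> = rexp (p n) (pairs {1..n}) (\<lambda>E. of_bool (\<nexists>M. k_matching k E M \<and> card M = m))"
        by (intro rexp_cong) (simp add: B_def indicator_def)
      also have "\<dots> \<le> k * exp (- (R n / 4))"
        unfolding R_def using assms \<epsilon> \<delta> p d g elim m
        by (intro no_k_matching_small[where \<epsilon> = \<epsilon> and \<delta> = \<delta>]) (auto simp: good_def R_def T_def)
      finally have "1 - real k * exp (- (R n / 4)) \<le> measure_pmf.prob (gnp n (p n)) (- B)"
        using measure_pmf.prob_compl[of B "gnp n (p n)"] by (simp add: Compl_eq_Diff_UNIV)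
      also have "\<dots> \<le> measure_pmf.prob (gnp n (p n)) (S n)"
      proof (intro measure_pmf.finite_measure_mono)
        have "(1 - \<epsilon>') * T n \<le> m" "m \<le> (1 + \<epsilon>') * T n"
          using m \<epsilon> T0 mult_right_mono[of "1 - \<epsilon>'" "1 - \<epsilon>" "T n"]
            mult_right_mono[of "1 - \<epsilon> / 2" "1 + \<epsilon>'" "T n"] by linarith+
        then show "- B \<subseteq> S n" by (auto simp: B_def S_def)
      qed simp
      finally show ?case .
    qed
    have "((\<lambda>x. 1 - real k * exp (- (x / 4))) \<longlongrightarrow> 1) at_top" by real_asymp
    then have "(\<lambda>n. 1 - real k * exp (- (R n / 4))) \<longlonglongrightarrow> 1"
      using R by (rule filterlim_compose)
    from tendsto_sandwich[OF bound _ this tendsto_const]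
    have "(\<lambda>n. measure_pmf.prob (gnp n (p n)) (S n)) \<longlonglongrightarrow> 1" by simp
    then show "(\<lambda>n. measure_pmf.prob (gnp n (p n)) {E. \<exists>M. k_matching k E M \<and>
             (1 - \<epsilon>') * (real k * real n * ln (d n) / (4 * d n ^ (k - 1))) \<le> real (card M) \<and>
             real (card M) \<le> (1 + \<epsilon>') * (real k * real n * ln (d n) / (4 * d n ^ (k - 1)))}) \<longlonglongrightarrow> 1"
      by (simp add: S_def T_def)
  qed auto
qed

end
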